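(* Let $F\colon\mathbb R^n\times\mathbb R^m\to\mathbb R$ be locally Lipschitz continuous, let $X\subset\mathbb R^n$ be nonempty and closed, let $c\in\mathbb R^m$ and $B\in\mathbb R^{q\times m}$, and let $A\colon\mathbb R^n\to\mathbb R^q$ be continuous. For each $x\in\mathbb R^n$ let $$S(x):=\operatorname{argmin}_y\{c^\top y\mid A(x)+By\le 0\}.$$ Let $(\bar x,\bar y)\in\mathbb R^n\times\mathbb R^m$ be a local minimizer of the bilevel optimization problem $$\min_{x,y}\{F(x,y)\mid x\in X,\ y\in S(x)\}.$$ Then this bilevel optimization problem is partially calm at $(\bar x,\bar y)$.
   Context: All spaces (including products) are equipped with the maximum norm $\|\cdot\|_\infty$; $\mathbb B_\delta(z)$ denotes the closed ball of radius $\delta$ around $z$. Inequalities between vectors are componentwise. $\operatorname{argmin}$ denotes the (possibly empty) set of global minimizers. Optimal value function: $\varphi(x):=\inf_y\{c^\top y\mid A(x)+By\le 0\}\in[-\infty,+\infty]$ for $x\in\mathbb R^n$, with $\inf\varnothing=+\infty$. Partial calmness: the bilevel problem $\min_{x,y}\{F(x,y)\mid x\in X,\ y\in S(x)\}$ is called partially calm at its local minimizer $(\bar x,\bar y)$ if there exist $\delta>0$ and $\bar\kappa>0$ such that for each triplet $(x,y,u)\in\mathbb B_\delta(\bar x,\bar y,0)\subset\mathbb R^n\times\mathbb R^m\times\mathbb R$ satisfying $$x\in X,\quad c^\top y-\varphi(x)\le u,\quad A(x)+By\le 0,$$ one has $F(x,y)+\bar\kappa|u|\ge F(\bar x,\bar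 y)$. *)

theory Defs
  imports "HOL-Analysis.Analysis"
begin

(* On a product of Euclidean spaces, the basis consists of the basis vectors of the factors,
   so infnorm on the product type is the maximum norm of the product. *)
definition max_cball :: "'a::euclidean_space \<Rightarrow> real \<Rightarrow> 'a set" where
  "max_cball z \<delta> = {w. infnorm (w - z) \<le> \<delta>}"

definition locally_lipschitz :: "('a::euclidean_space \<Rightarrow> real) \<Rightarrow> bool" where
  "locally_lipschitz F \<longleftrightarrow>
     (\<forall>z. \<exists>\<delta>>0. \<exists>L\<ge>0. \<forall>v\<in>max_cball z \<delta>. \<forall>w\<in>max_cball z \<delta>.
        \<bar>F v - F w\<bar> \<le> L * infnorm (v - w))"

(* The order on real ^ 'q is componentwise. *)
definition lower_feasible ::
  "(real^'n \<Rightarrow> real^'q) \<Rightarrow> real^'m^'q \<Rightarrow> real^'n \<Rightarrow> (real^'m) set" where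
  "lower_feasible A B x = {y. A x + B *v y \<le> 0}"

definition lower_solutions ::
  "real^'m \<Rightarrow> (real^'n \<Rightarrow> real^'q) \<Rightarrow> real^'m^'q \<Rightarrow> real^'n \<Rightarrow> (real^'m) set" where
  "lower_solutions c A B x =
     {y. is_arg_min (\<lambda>y. c \<bullet> y) (\<lambda>y. y \<in> lower_feasible A B x) y}"

definition optimal_value ::
  "real^'m \<Rightarrow> (real^'n \<Rightarrow> real^'q) \<Rightarrow> real^'m^'q \<Rightarrow> real^'n \<Rightarrow> ereal" where
  "optimal_value c A B x = (INF y\<in>lower_feasible A B x. ereal (c \<bullet> y))"

definition local_minimizer :: "('a::euclidean_space \<Rightarrow> real) \<Rightarrow> 'a set \<Rightarrow> 'a \<Rightarrow> bool" where
  "local_minimizer F M z \<longleftrightarrow>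
     z \<in> M \<and> (\<exists>\<epsilon>>0. \<forall>w \<in> M \<inter> max_cball z \<epsilon>. F z \<le> F w)"

definition bilevel_feasible ::
  "(real^'n) set \<Rightarrow> real^'m \<Rightarrow> (real^'n \<Rightarrow> real^'q) \<Rightarrow> real^'m^'q \<Rightarrow> ((real^'n) \<times> (real^'m)) set" where
  "bilevel_feasible X c A B = {(x, y). x \<in> X \<and> y \<in> lower_solutions c A B x}"

(* In ereal, c \<bullet> y - (- \<infinity>) = \<infinity>, so the value constraint fails for every real u
   when the lower level problem at x is unbounded; the case of value + \<infinity> is ruled out by
   the constraint on y. *)
definition partially_calm ::
  "((real^'n) \<times> (real^'m) \<Rightarrow> real) \<Rightarrow> (real^'n) set \<Rightarrow> real^'m \<Rightarrow> (real^'n \<Rightarrow> real^'q) \<Rightarrow> real^'m^'q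
    \<Rightarrow> real^'n \<Rightarrow> real^'m \<Rightarrow> bool" where
  "partially_calm F X c A B xbar ybar \<longleftrightarrow>
     (\<exists>\<delta>>0. \<exists>\<kappa>>0. \<forall>x y u.
        (x, y, u) \<in> max_cball (xbar, ybar, 0) \<delta> \<and>
        x \<in> X \<and>
        ereal (c \<bullet> y) - optimal_value c A B x \<le> ereal u \<and>
        A x + B *v y \<le> 0
        \<longrightarrow> F (x, y) + \<kappa> * \<bar>u\<bar> \<ge> F (xbar, ybar))"

end

theory Submission imports Defs begin

text \<open>The key is an error bound for the lower level linear program that is uniform in the right-hand
side: a feasible point \<open>y\<close> has an optimal solution within distance
\<open>(c \<bullet> y - \<phi>) / \<epsilon>\<close>, where \<open>\<epsilon>\<close> depends only on \<open>B\<close> and \<open>c\<close>. Take \<open>\<epsilon>\<close> below the finitely many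
descent rates attached to the possible active index sets and minimize the coercive function
\<open>c \<bullet> z + \<epsilon> * norm (z - y)\<close> over the feasible set. At its minimizer no descent direction survives,
hence the minimizer solves the linear program. Moving the given point to this solution costs at
most a multiple of \<open>\<bar>u\<bar>\<close> by Lipschitz continuity of \<open>F\<close>.\<close>

lemma infnorm_Pair: "infnorm (a, b) = max (infnorm a) (infnorm b)"
  unfolding infnorm_Max Basis_prod_def
  by (simp add: image_Un image_image Max_Un)

text \<open>For a fixed \<open>I\<close>, either the cone of admissible directions contains no
  descent direction and nothing is claimed, or one normalized direction serves every
  \<open>v\<close>. Only finitely many \<open>I\<close> exist, so the smallest rate is still
  positive. In use, \<open>I\<close> is the set of constraints active at a point, so the rate does
  not depend on the right-hand side.\<close>

lemma uniform_descent_rate: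
  fixes c :: "real^'m" and B :: "real^'m^'q"
  obtains \<epsilon> where "\<epsilon> > 0"
    and "\<And>I v. c \<bullet> v < 0 \<Longrightarrow> \<forall>i\<in>I. (B *v v) $ i \<le> 0 \<Longrightarrow>
           \<exists>d. norm d = 1 \<and> c \<bullet> d < - \<epsilon> \<and> (\<forall>i\<in>I. (B *v d) $ i \<le> 0)"
proof -
  define R where "R I \<epsilon> \<longleftrightarrow> (\<forall>v. c \<bullet> v < 0 \<longrightarrow> (\<forall>i\<in>I. (B *v v) $ i \<le> 0) \<longrightarrow>
           (\<exists>d. norm d = 1 \<and> c \<bullet> d < - \<epsilon> \<and> (\<forall>i\<in>I. (B *v d) $ i \<le> 0)))" for I \<epsilon>
  have "\<exists>\<epsilon>>0. R I \<epsilon>" for I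
  proof (cases "\<exists>v. c \<bullet> v < 0 \<and> (\<forall>i\<in>I. (B *v v) $ i \<le> 0)")
    case True
    then obtain v where v: "c \<bullet> v < 0" "\<forall>i\<in>I. (B *v v) $ i \<le> 0" by blast
    define d where "d = (1 / norm v) *\<^sub>R v"
    have "v \<noteq> 0" using v by auto
    then have "norm d = 1" and "c \<bullet> d < 0" and "\<forall>i\<in>I. (B *v d) $ i \<le> 0"
      using v by (auto simp: d_def matrix_vector_mult_scaleR divide_less_0_iff divide_le_0_iff)
    \<comment> \<open>Halving the rate of \<open>d\<close> makes the required inequality
      strict.\<close>
    then have "R I (- (c \<bullet> d) / 2)" unfolding R_def by (auto intro!: exI[of _ d])
    then show ?thesis using \<open>c \<bullet> d < 0\<close> by (intro exI[of _ "- (c \<bullet> d) / 2"]) auto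
  next
    case False
    then show ?thesis unfolding R_def by (intro exI[of _ 1]) auto
  qed
  then obtain e where e: "\<And>I. e I > 0" "\<And>I. R I (e I)" by metis
  \<comment> \<open>The index sets are subsets of a finite type, so \<open>range e\<close> is finite
    and the minimum is attained.\<close>
  define \<epsilon> where "\<epsilon> = Min (range e)"
  have le: "\<epsilon> \<le> e I" for I by (simp add: \<epsilon>_def)
  have "\<epsilon> > 0" using e(1) by (simp add: \<epsilon>_def)
  then show thesis
  proof (rule that)
    fix I v assume "c \<bullet> v < 0" "\<forall>i\<in>I. (B *v v) $ i \<le> 0"
    then obtain d where "norm d = 1" "c \<bullet> d < - e I" "\<forall>i\<in>I. (B *v d) $ i \<le> 0"
      using e(2)[of I] unfolding R_def by blast
    then show "\<exists>d. norm d = 1 \<and> c \<bullet> d < - \<epsilon> \<and> (\<forall>i\<in>I. (B *v d) $ i \<le> 0)"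
      using le[of I] by (intro exI[of _ d]) auto
  qed
qed

lemma closed_polyhedron_matrix:
  fixes B :: "real^'m^'q"
  shows "closed {z. B *v z \<le> b}"
  unfolding less_eq_vec_def
  by (intro closed_Collect_all closed_Collect_le continuous_intros)

text \<open>In an unbounded set, the normalized directions from \<open>y\<close> to points ever
  farther away accumulate at a unit vector \<open>l\<close>. In the limit \<open>l\<close> is a
  recession direction along which the objective falls at rate at least \<open>\<epsilon>\<close>,
  contrary to \<open>rec\<close>.\<close>

lemma bounded_penalized_sublevel:
  fixes c :: "real^'m" and B :: "real^'m^'q"
  assumes rec: "\<And>d. B *v d \<le> 0 \<Longrightarrow> 0 \<le> c \<bullet> d"
    and "\<epsilon> > 0"
  shows "bounded {z. B *v z \<le> b \<and> c \<bullet> z + \<epsilon> * norm (z - y) \<le> c \<bullet> y}" (is "bounded ?K")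
proof (rule ccontr)
  assume unb: "\<not> bounded ?K"
  have "\<exists>z\<in>?K. norm (z - y) > real n + 1" for n
  proof (rule ccontr)
    assume "\<not> (\<exists>z\<in>?K. norm (z - y) > real n + 1)"
    then have "?K \<subseteq> cball y (real n + 1)" by (force simp: dist_norm norm_minus_commute)
    then show False using unb bounded_subset bounded_cball by blast
  qed
  then have "\<forall>n. \<exists>z. z \<in> ?K \<and> norm (z - y) > real n + 1" by blast
  from choice[OF this] obtain z where z: "\<And>n. z n \<in> ?K" "\<And>n. norm (z n - y) > real n + 1"
    by blast
  define r where "r n = norm (z n - y)" for n
  define d where "d n = (1 / r n) *\<^sub>R (z n - y)" for n
  have r: "r n > real n + 1" for n using z(2) by (simp add: r_def)
  then have r0: "r n > 0" for n by (smt (verit) of_nat_0_le_iff)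
  have "d n \<in> sphere 0 1" for n using r0[of n] by (simp add: d_def r_def)
  then obtain l \<sigma> where l: "l \<in> sphere 0 1" "strict_mono (\<sigma> :: nat \<Rightarrow> nat)" "(d \<circ> \<sigma>) \<longlonglongrightarrow> l"
    using compact_sphere[of "0::real^'m" 1] unfolding compact_def by metis
  have r_inf: "filterlim r at_top sequentially"
  proof (rule filterlim_at_top_mono)
    show "filterlim (\<lambda>n. real n) at_top sequentially" by (rule filterlim_real_sequentially)
    show "\<forall>\<^sub>F n in sequentially. real n \<le> r n" using r by (intro always_eventually) (smt (verit))
  qed
  have "(\<lambda>n. 1 / r n) \<longlonglongrightarrow> 0"
    using tendsto_inverse_0_at_top[OF r_inf] by (simp add: inverse_eq_divide)
  then have inv0: "(\<lambda>n. 1 / r (\<sigma> n)) \<longlonglongrightarrow> 0"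
    using LIMSEQ_subseq_LIMSEQ[OF _ l(2), of "\<lambda>n. 1 / r n"] by (simp add: o_def)
  have dl: "(\<lambda>n. d (\<sigma> n)) \<longlonglongrightarrow> l" using l(3) by (simp add: o_def)
  \<comment> \<open>Divide \<open>B *v (z n - y) \<le> b - B *v y\<close> by \<open>r n\<close>; the
    right-hand side vanishes in the limit.\<close>
  have "(B *v l) $ i \<le> 0" for i
  proof (rule LIMSEQ_le)
    show "(\<lambda>n. (B *v d (\<sigma> n)) $ i) \<longlonglongrightarrow> (B *v l) $ i"
      by (intro tendsto_vec_nth bounded_linear.tendsto[OF matrix_vector_mul_bounded_linear] dl)
    show "(\<lambda>n. 1 / r (\<sigma> n) * (b - B *v y) $ i) \<longlonglongrightarrow> 0"
      using tendsto_mult_left_zero[OF inv0] .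
    have "(B *v d n) $ i \<le> 1 / r n * (b - B *v y) $ i" for n
      using z(1)[of n] r0[of n]
      by (auto simp: d_def matrix_vector_mult_scaleR matrix_vector_mult_diff_distrib less_eq_vec_def
          intro!: divide_right_mono)
    then show "\<exists>N. \<forall>n\<ge>N. (B *v d (\<sigma> n)) $ i \<le> 1 / r (\<sigma> n) * (b - B *v y) $ i" by blast
  qed
  then have "0 \<le> c \<bullet> l" by (intro rec) (simp add: less_eq_vec_def)
  \<comment> \<open>Division by \<open>r n\<close> turns the penalty \<open>\<epsilon> * r n\<close>
    into the constant \<open>\<epsilon>\<close>.\<close>
  moreover have "c \<bullet> l \<le> - \<epsilon>"
  proof (rule LIMSEQ_le_const2)
    show "(\<lambda>n. c \<bullet> d (\<sigma> n)) \<longlonglongrightarrow> c \<bullet> l" by (intro tendsto_intros dl)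
    have "c \<bullet> d n \<le> - \<epsilon>" for n
      using z(1)[of n] r0[of n] by (simp add: d_def inner_diff_right field_simps flip: r_def)
    then show "\<exists>N. \<forall>n\<ge>N. c \<bullet> d (\<sigma> n) \<le> - \<epsilon>" by blast
  qed
  ultimately show False using \<open>\<epsilon> > 0\<close> by simp
qed

text \<open>Here \<open>\<epsilon>\<close> is fixed before \<open>b\<close> and \<open>y\<close>, so
  one constant serves all parameters \<open>x\<close> at once through \<open>b = - A x\<close>. The
  condition \<open>rec\<close> involves only recession directions and is likewise independent of
  \<open>b\<close>.\<close>

lemma linear_program_error_bound:
  fixes c :: "real^'m" and B :: "real^'m^'q"
  assumes rec: "\<And>d. B *v d \<le> 0 \<Longrightarrow> 0 \<le> c \<bullet> d"
  obtains \<epsilon> where "\<epsilon> > 0"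
    and "\<And>b y. B *v y \<le> b \<Longrightarrow>
      \<exists>z. B *v z \<le> b \<and> (\<forall>w. B *v w \<le> b \<longrightarrow> c \<bullet> z \<le> c \<bullet> w) \<and> \<epsilon> * norm (z - y) \<le> c \<bullet> y - c \<bullet> z"
proof -
  obtain \<epsilon> where \<epsilon>: "\<epsilon> > 0"
    and descent: "\<And>I v. c \<bullet> v < 0 \<Longrightarrow> \<forall>i\<in>I. (B *v v) $ i \<le> 0 \<Longrightarrow>
           \<exists>d. norm d = 1 \<and> c \<bullet> d < - \<epsilon> \<and> (\<forall>i\<in>I. (B *v d) $ i \<le> 0)"
    using uniform_descent_rate[of c B] by blast
  show thesis
  proof (rule that[OF \<epsilon>])
    fix b y assume y: "B *v y \<le> b"
    define g where "g z = c \<bullet> z + \<epsilon> * norm (z - y)" for z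
    have cont: "continuous_on S g" for S unfolding g_def by (intro continuous_intros)
    define K where "K = {z. B *v z \<le> b \<and> g z \<le> c \<bullet> y}"
    have "closed {z. g z \<le> c \<bullet> y}"
      by (intro closed_Collect_le cont continuous_intros)
    then have "closed K" unfolding K_def
      using closed_Int[OF closed_polyhedron_matrix[of B b]] by (simp add: Collect_conj_eq)
    moreover have "bounded K"
      unfolding K_def g_def by (rule bounded_penalized_sublevel[OF rec \<epsilon>])
    moreover have "y \<in> K" using y by (simp add: K_def g_def)
    ultimately obtain z where z: "z \<in> K" "\<And>w. w \<in> K \<Longrightarrow> g z \<le> g w"
      using continuous_attains_inf[OF _ _ cont, of K] by (auto simp: compact_eq_bounded_closed)
    have zb: "B *v z \<le> b" and gz: "g z \<le> c \<bullet> y" using z(1) by (auto simp: K_def)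
    \<comment> \<open>Feasible points outside \<open>K\<close> have penalized value above
      \<open>c \<bullet> y\<close>, so the minimum over \<open>K\<close> is the minimum over the
      whole polyhedron.\<close>
    have min: "g z \<le> g w" if "B *v w \<le> b" for w
      using that z(2)[of w] gz by (cases "w \<in> K") (auto simp: K_def)
    \<comment> \<open>A better \<open>w\<close> would give the descent direction
      \<open>w - z\<close>, compatible with the constraints active at \<open>z\<close>. It can be
      traded for a unit \<open>d\<close> along which the objective falls faster than the penalty can
      grow, contradicting minimality of \<open>z\<close> for \<open>g\<close>.\<close>
    have "c \<bullet> z \<le> c \<bullet> w" if w: "B *v w \<le> b" for w
    proof (rule ccontr)
      assume "\<not> c \<bullet> z \<le> c \<bullet> w"
      then have v: "c \<bullet> (w - z) < 0" by (simp add: inner_diff_right)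
      define I where "I = {i. (B *v z) $ i = b $ i}"
      have "\<forall>i\<in>I. (B *v (w - z)) $ i \<le> 0"
        using w by (auto simp: I_def matrix_vector_mult_diff_distrib less_eq_vec_def)
      then obtain d where d: "norm d = 1" "c \<bullet> d < - \<epsilon>" "\<forall>i\<in>I. (B *v d) $ i \<le> 0"
        using descent[OF v] by blast
      \<comment> \<open>Active constraints survive every positive step by the choice of
        \<open>d\<close>; inactive ones have slack and survive small steps by continuity.\<close>
      have "\<forall>\<^sub>F t in at_right 0. (B *v (z + t *\<^sub>R d)) $ i \<le> b $ i" for i
      proof (cases "i \<in> I")
        case True
        then have "(B *v (z + t *\<^sub>R d)) $ i \<le> b $ i" if "t > 0" for t
          using d(3) that
          by (auto simp: I_def matrix_vector_right_distrib matrix_vector_mult_scaleR mult_le_0_iff)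
        then show ?thesis by (auto simp: eventually_at_filter)
      next
        case False
        then have lt: "(B *v z) $ i < b $ i" using zb by (auto simp: I_def less_eq_vec_def less_le)
        have "((\<lambda>t. (B *v z) $ i + t * (B *v d) $ i) \<longlongrightarrow> (B *v z) $ i + 0 * (B *v d) $ i) (at_right 0)"
          by (intro tendsto_intros)
        then have "\<forall>\<^sub>F t in at_right 0. (B *v z) $ i + t * (B *v d) $ i < b $ i"
          using lt by (intro order_tendstoD) auto
        then show ?thesis
          by eventually_elim (simp add: matrix_vector_right_distrib matrix_vector_mult_scaleR)
      qed
      then have "\<forall>\<^sub>F t in at_right 0. \<forall>i. (B *v (z + t *\<^sub>R d)) $ i \<le> b $ i"
        by (simp add: eventually_all_finite)
      then have "\<forall>\<^sub>F t in at_right (0::real). t > 0 \<and> B *v (z + t *\<^sub>R d) \<le> b"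
        using eventually_at_right_less[of "0::real"]
        by eventually_elim (simp add: less_eq_vec_def)
      then obtain t where t: "t > 0" "B *v (z + t *\<^sub>R d) \<le> b"
        using eventually_happens'[OF trivial_limit_at_right_real] by blast
      have "norm (z + t *\<^sub>R d - y) \<le> norm (z - y) + t"
        using norm_triangle_ineq[of "z - y" "t *\<^sub>R d"] d(1) t(1) by (simp add: algebra_simps)
      then have "\<epsilon> * norm (z + t *\<^sub>R d - y) \<le> \<epsilon> * norm (z - y) + t * \<epsilon>"
        using \<epsilon> by (metis distrib_left mult.commute mult_le_cancel_left_pos)
      moreover have "t * (c \<bullet> d) < t * (- \<epsilon>)" using d(2) t(1) by (rule mult_strict_left_mono)
      ultimately have "g (z + t *\<^sub>R d) < g z" by (simp add: g_def inner_add_right)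
      then show False using min[OF t(2)] by simp
    qed
    \<comment> \<open>Since \<open>g y = c \<bullet> y\<close>, the error bound is just the
      comparison of \<open>g z\<close> with \<open>g y\<close>.\<close>
    moreover have "\<epsilon> * norm (z - y) \<le> c \<bullet> y - c \<bullet> z" using gz by (simp add: g_def)
    ultimately show "\<exists>z. B *v z \<le> b \<and> (\<forall>w. B *v w \<le> b \<longrightarrow> c \<bullet> z \<le> c \<bullet> w)
        \<and> \<epsilon> * norm (z - y) \<le> c \<bullet> y - c \<bullet> z"
      using zb by blast
  qed
qed

lemma lower_feasible_iff: "y \<in> lower_feasible A B x \<longleftrightarrow> B *v y \<le> - A x"
  by (simp add: lower_feasible_def less_eq_vec_def real_add_le_0_iff)

lemma lower_solutions_iff:
  "y \<in> lower_solutions c A B x \<longleftrightarrow>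
     y \<in> lower_feasible A B x \<and> (\<forall>w\<in>lower_feasible A B x. c \<bullet> y \<le> c \<bullet> w)"
  by (auto simp: lower_solutions_def is_arg_min_def not_less)

lemma optimal_value_eq:
  assumes "y \<in> lower_solutions c A B x"
  shows "optimal_value c A B x = ereal (c \<bullet> y)"
  unfolding optimal_value_def
  using assms by (intro antisym INF_lower INF_greatest) (auto simp: lower_solutions_iff)

text \<open>A step along \<open>d\<close> keeps an optimal \<open>y\<close> feasible, so it cannot
  lower the objective. The conclusion no longer mentions \<open>x\<close>: solvability at one
  parameter supplies the hypothesis of the error bound for all parameters.\<close>

lemma recession_nonneg:
  assumes "y \<in> lower_solutions c A B x" and d: "B *v d \<le> 0"
  shows "0 \<le> c \<bullet> d"
proof -
  have "y + d \<in> lower_feasible A B x"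
    using assms add_mono[of "B *v y" "- A x" "B *v d" 0]
    by (simp add: lower_solutions_iff lower_feasible_iff matrix_vector_right_distrib)
  then have "c \<bullet> y \<le> c \<bullet> (y + d)" using assms(1) by (simp add: lower_solutions_iff)
  then show ?thesis by (simp add: inner_add_right)
qed

theorem theorem4p1:
  fixes F :: "(real^'n) \<times> (real^'m) \<Rightarrow> real"
    and X :: "(real^'n) set"
    and c :: "real^'m"
    and B :: "real^'m^'q"
    and A :: "real^'n \<Rightarrow> real^'q"
    and xbar :: "real^'n"
    and ybar :: "real^'m"
  assumes "locally_lipschitz F"
    and "X \<noteq> {}" and "closed X"
    and "continuous_on UNIV A"
    and "local_minimizer F (bilevel_feasible X c A B) (xbar, ybar)"
  shows "partially_calm F X c A B xbar ybar"
proof -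
  obtain r L where r: "r > 0" and L: "L \<ge> 0"
    and lip: "\<And>v w. v \<in> max_cball (xbar, ybar) r \<Longrightarrow> w \<in> max_cball (xbar, ybar) r \<Longrightarrow>
                 \<bar>F v - F w\<bar> \<le> L * infnorm (v - w)"
    using assms(1) unfolding locally_lipschitz_def by blast
  obtain s where s: "s > 0"
    and opt: "\<And>w. w \<in> bilevel_feasible X c A B \<Longrightarrow> w \<in> max_cball (xbar, ybar) s \<Longrightarrow>
                 F (xbar, ybar) \<le> F w"
    using assms(5) unfolding local_minimizer_def by blast
  have "ybar \<in> lower_solutions c A B xbar"
    using assms(5) by (simp add: local_minimizer_def bilevel_feasible_def)
  then have "\<And>d. B *v d \<le> 0 \<Longrightarrow> 0 \<le> c \<bullet> d" by (rule recession_nonneg)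
  then obtain \<epsilon> where \<epsilon>: "\<epsilon> > 0"
    and bound: "\<And>b y. B *v y \<le> b \<Longrightarrow>
      \<exists>z. B *v z \<le> b \<and> (\<forall>w. B *v w \<le> b \<longrightarrow> c \<bullet> z \<le> c \<bullet> w) \<and> \<epsilon> * norm (z - y) \<le> c \<bullet> y - c \<bullet> z"
    using linear_program_error_bound[of B c] by blast
  \<comment> \<open>Within radius \<open>m\<close> both the Lipschitz estimate and local optimality
    are available. The next choice solves \<open>\<delta> + \<delta> / \<epsilon> = m\<close>:
    \<open>y\<close> is within \<open>\<delta>\<close> of \<open>ybar\<close>, and the lower level
    solution \<open>z\<close> will be within \<open>\<delta> / \<epsilon>\<close> of
    \<open>y\<close>.\<close>
  define m where "m = min r s"
  define \<delta> where "\<delta> = m / (1 + 1 / \<epsilon>)"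
  have den: "1 + 1 / \<epsilon> > 0" using \<epsilon> by (simp add: add_pos_pos)
  have \<delta>: "\<delta> > 0" using r s den by (simp add: \<delta>_def m_def)
  have "\<delta> * (1 + 1 / \<epsilon>) = m"
    unfolding \<delta>_def using den by (intro nonzero_eq_divide_eq[THEN iffD1]) auto
  then have \<delta>m: "\<delta> + \<delta> / \<epsilon> = m" by (simp add: distrib_left)
  have "\<delta> / \<epsilon> > 0" using \<delta> \<epsilon> by simp
  then have "\<delta> \<le> r" using \<delta>m by (simp add: m_def)
  \<comment> \<open>Passing from \<open>y\<close> to \<open>z\<close> costs at most
    \<open>L / \<epsilon> * \<bar>u\<bar>\<close>; the summand 1 keeps the penalty constant positive
    when \<open>L = 0\<close>.\<close>
  have calm: "F (xbar, ybar) \<le> F (x, y) + (L / \<epsilon> + 1) * \<bar>u\<bar>"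
    if near: "(x, y, u) \<in> max_cball (xbar, ybar, 0) \<delta>" and "x \<in> X"
      and val: "ereal (c \<bullet> y) - optimal_value c A B x \<le> ereal u" and "A x + B *v y \<le> 0" for x y u
  proof -
    have nx: "infnorm (x - xbar) \<le> \<delta>" and ny: "infnorm (y - ybar) \<le> \<delta>" and nu: "\<bar>u\<bar> \<le> \<delta>"
      using near by (auto simp: max_cball_def infnorm_Pair infnorm_Max[of u])
    have "y \<in> lower_feasible A B x" using that by (simp add: lower_feasible_def)
    then obtain z where z: "z \<in> lower_solutions c A B x"
      and err: "\<epsilon> * norm (z - y) \<le> c \<bullet> y - c \<bullet> z"
      using bound[of y "- A x"] by (auto simp: lower_solutions_iff lower_feasible_iff Ball_def)
    \<comment> \<open>The solution \<open>z\<close> attains the optimal value, so that value is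
      finite and the extended-real constraint becomes a real inequality.\<close>
    have "c \<bullet> y - c \<bullet> z \<le> \<bar>u\<bar>" using val by (simp add: optimal_value_eq[OF z])
    then have "\<epsilon> * infnorm (z - y) \<le> \<bar>u\<bar>"
      using err \<epsilon> infnorm_le_norm[of "z - y"] by (smt (verit) mult_left_mono)
    then have nz: "infnorm (z - y) \<le> \<bar>u\<bar> / \<epsilon>" using \<epsilon> by (simp add: field_simps)
    then have "infnorm (z - y) \<le> \<delta> / \<epsilon>" using nu \<epsilon> by (smt (verit) divide_right_mono)
    then have "infnorm (z - ybar) \<le> m"
      using infnorm_triangle[of "z - y" "y - ybar"] ny \<delta>m by simp
    moreover have "infnorm (x - xbar) \<le> m" using nx \<delta>m \<open>\<delta> / \<epsilon> > 0\<close> by simp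
    ultimately have zm: "(x, z) \<in> max_cball (xbar, ybar) r" "(x, z) \<in> max_cball (xbar, ybar) s"
      by (auto simp: max_cball_def infnorm_Pair m_def)
    \<comment> \<open>The pair \<open>(x, z)\<close> is feasible for the bilevel problem, unlike
      \<open>(x, y)\<close> in general, so local optimality applies to it.\<close>
    have "F (xbar, ybar) \<le> F (x, z)"
      using opt[of "(x, z)"] zm z \<open>x \<in> X\<close> by (simp add: bilevel_feasible_def)
    also have "\<dots> \<le> F (x, y) + L * infnorm ((x, z) - (x, y))"
      using lip[of "(x, z)" "(x, y)"] zm nx ny \<open>\<delta> \<le> r\<close> by (auto simp: max_cball_def infnorm_Pair)
    also have "\<dots> \<le> F (x, y) + L * (\<bar>u\<bar> / \<epsilon>)"
      using nz L infnorm_pos_le[of "z - y"]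
      by (intro add_left_mono mult_left_mono) (auto simp: infnorm_Pair infnorm_0)
    also have "\<dots> \<le> F (x, y) + (L / \<epsilon> + 1) * \<bar>u\<bar>" by (simp add: algebra_simps)
    finally show ?thesis .
  qed
  have "L / \<epsilon> + 1 > 0" using L \<epsilon> by (simp add: add_nonneg_pos)
  then show ?thesis
    unfolding partially_calm_def using \<delta> calm by blast
qed

end
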